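(* Let $p$ and $q$ be distinct primes, let $G$ be a cyclic group of order $p^2q^2$ with identity $e_G$, let $S_1=\{x\in G: |x|=p \text{ or } |x|=q\}$, $S_2=\{x\in G: |x|=p^2 \text{ or } |x|=q^2\}$, $S_3=\{e_G\}$. Then the chromatic number of the Bi-Cayley graph $\Gamma=\mathrm{BiCay}(G;S_1,S_2,S_3)$ is $\max\{p,q\}+1$.
   Context: $|x|$ denotes the order of the element $x$. For a group $G$ and nonempty subsets $S_1,S_2,S_3\subseteq G$ with $S_1,S_2,S_3$ inverse-closed and $e_G\notin S_1\cup S_2$, the Bi-Cayley graph $\mathrm{BiCay}(G;S_1,S_2,S_3)$ is the simple graph with vertex set $\{0,1\}\times G$ in which two distinct vertices $(i,x),(j,y)$ are adjacent iff: $xy^{-1}\in S_1$ when $i=j=0$; $xy^{-1}\in S_2$ when $i=j=1$; $xy^{-1}\in S_3$ when $i\ne j$. *)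

theory Defs
  imports
    "HOL-Algebra.Elementary_Groups"
    "HOL-Algebra.Multiplicative_Group"
    "HOL-Computational_Algebra.Primes"
    "Graph_Theory.Pair_Digraph"
begin

text \<open>
  A finite simple graph is a \<^locale>\<open>pair_graph\<close>: a finite, loopless, symmetric digraph whose arcs
  are ordered pairs of vertices, so that each edge appears as two opposite arcs.
\<close>

definition proper_coloring :: "'v pair_pre_digraph \<Rightarrow> nat \<Rightarrow> ('v \<Rightarrow> nat) \<Rightarrow> bool" where
  "proper_coloring \<Gamma> k c \<longleftrightarrow>
     (\<forall>v \<in> pverts \<Gamma>. c v < k) \<and> (\<forall>(u, v) \<in> parcs \<Gamma>. c u \<noteq> c v)"

text \<open>Every finite loopless graph has a proper coloring, so \<open>LEAST\<close> is well defined for these.\<close>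

definition chromatic_number :: "'v pair_pre_digraph \<Rightarrow> nat" where
  "chromatic_number \<Gamma> = (LEAST k. \<exists>c. proper_coloring \<Gamma> k c)"

definition BiCay ::
  "('a, 'b) monoid_scheme \<Rightarrow> 'a set \<Rightarrow> 'a set \<Rightarrow> 'a set \<Rightarrow> (nat \<times> 'a) pair_pre_digraph" where
  "BiCay G S1 S2 S3 =
     \<lparr> pverts = {0, 1} \<times> carrier G,
       parcs = {((i, x), (j, y)) | i x j y.
         (i, x) \<in> {0, 1} \<times> carrier G \<and> (j, y) \<in> {0, 1} \<times> carrier G \<and>
         (i, x) \<noteq> (j, y) \<and>
         (i = 0 \<and> j = 0 \<and> x \<otimes>\<^bsub>G\<^esub> inv\<^bsub>G\<^esub> y \<in> S1 \<or>
          i = 1 \<and> j = 1 \<and> x \<otimes>\<^bsub>G\<^esub> inv\<^bsub>G\<^esub> y \<in> S2 \<or>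
          i \<noteq> j \<and> x \<otimes>\<^bsub>G\<^esub> inv\<^bsub>G\<^esub> y \<in> S3)} \<rparr>"

text \<open>
  Adjacency is written with \<open>x \<otimes> inv y\<close> for both orders of the endpoints; it is symmetric because
  the connection sets are inverse-closed. This condition, nonemptiness, and absence of the identity
  from \<open>S1\<close> and \<open>S2\<close> are left to the user of the definition.
\<close>

lemma (in group) pair_graph_BiCay:
  assumes fin: "finite (carrier G)"
    and inv_closed: "\<And>x. x \<in> S1 \<Longrightarrow> inv x \<in> S1" "\<And>x. x \<in> S2 \<Longrightarrow> inv x \<in> S2"
      "\<And>x. x \<in> S3 \<Longrightarrow> inv x \<in> S3"
  shows "pair_graph (BiCay G S1 S2 S3)"
proof -
  let ?\<Gamma> = "BiCay G S1 S2 S3"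
  have fin_verts: "finite (pverts ?\<Gamma>)"
    using fin by (simp add: BiCay_def)
  have sub: "parcs ?\<Gamma> \<subseteq> pverts ?\<Gamma> \<times> pverts ?\<Gamma>"
    unfolding BiCay_def by fastforce
  then have fin_arcs: "finite (parcs ?\<Gamma>)"
    using fin_verts finite_subset by blast
  have swap: "y \<otimes> inv x \<in> S"
    if "x \<in> carrier G" "y \<in> carrier G" "x \<otimes> inv y \<in> S" "\<And>z. z \<in> S \<Longrightarrow> inv z \<in> S" for x y S
    using that(4)[OF that(3)] that(1,2) by (simp add: inv_mult_group)
  have "sym (parcs ?\<Gamma>)"
  proof (rule symI)
    fix u v
    assume uv: "(u, v) \<in> parcs ?\<Gamma>"
    obtain i x j y where eq: "u = (i, x)" "v = (j, y)"
      by (cases u, cases v)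
    have xy: "x \<in> carrier G" "y \<in> carrier G"
      using uv unfolding eq BiCay_def by auto
    show "(v, u) \<in> parcs ?\<Gamma>"
      using uv swap[OF xy _ inv_closed(1)] swap[OF xy _ inv_closed(2)] swap[OF xy _ inv_closed(3)]
      unfolding eq BiCay_def by auto
  qed
  moreover have "fst e \<noteq> snd e" if "e \<in> parcs ?\<Gamma>" for e
    using that by (auto simp: BiCay_def)
  ultimately show ?thesis
    using fin_verts fin_arcs sub by unfold_locales (auto simp: symmetric_def)
qed

end

theory Submission
  imports Defs
begin

text \<open>
  Lower bound: let \<open>h\<close> have order \<open>p\<^sup>2\<close>. In layer 1, each vertex \<open>h\<^sup>p\<^sup>a\<close> completes
  \<open>h, \<dots>, h\<^sup>p\<^sup>-\<^sup>1\<close> to a \<open>p\<close>-clique, so with only \<open>p\<close> colors these vertices all receive the same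
  color. In layer 0 the vertices \<open>h\<^sup>p\<^sup>a\<close> form a \<open>p\<close>-clique, so one of them receives that color as
  well, and it is joined to its copy in layer 1.

  Upper bound for \<open>q < p\<close>: identify \<open>G\<close> with the integers modulo \<open>p\<^sup>2q\<^sup>2\<close>. An arc of layer 1 changes
  exactly one of the residues modulo \<open>p\<close> and \<open>q\<close>, so their sum modulo \<open>p\<close> colors layer 1. An arc of
  layer 0 preserves these residues and changes exactly one of the next base-\<open>p\<close> and base-\<open>q\<close>
  digits, so the sum of these digits modulo \<open>p\<close> colors layer 0; where it clashes with layer 1 it is
  replaced by the extra color \<open>p\<close>.
\<close>

lemma BiCay_arc_iff:
  "((i, x), (j, y)) \<in> parcs (BiCay G S1 S2 S3) \<longleftrightarrow>
     i \<in> {0, 1} \<and> j \<in> {0, 1} \<and> x \<in> carrier G \<and> y \<in> carrier G \<and> (i, x) \<noteq> (j, y) \<and>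
     (i = 0 \<and> j = 0 \<and> x \<otimes>\<^bsub>G\<^esub> inv\<^bsub>G\<^esub> y \<in> S1 \<or>
      i = 1 \<and> j = 1 \<and> x \<otimes>\<^bsub>G\<^esub> inv\<^bsub>G\<^esub> y \<in> S2 \<or>
      i \<noteq> j \<and> x \<otimes>\<^bsub>G\<^esub> inv\<^bsub>G\<^esub> y \<in> S3)"
  by (auto simp: BiCay_def)

lemma BiCay_verts: "pverts (BiCay G S1 S2 S3) = {0, 1} \<times> carrier G"
  by (simp add: BiCay_def)

lemma proper_coloring_arc:
  "proper_coloring \<Gamma> k c \<Longrightarrow> (u, v) \<in> parcs \<Gamma> \<Longrightarrow> c u \<noteq> c v"
  by (auto simp: proper_coloring_def)

lemma chromatic_number_eqI:
  assumes "proper_coloring \<Gamma> k c" and "\<And>l c. proper_coloring \<Gamma> l c \<Longrightarrow> k \<le> l"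
  shows "chromatic_number \<Gamma> = k"
  unfolding chromatic_number_def using assms by (intro Least_equality) auto

section \<open>Orders of powers and divisibility of exponents\<close>

lemma (in group) ord_int_pow_dvd_iff:
  assumes "g \<in> carrier G"
  shows "ord (g [^] (i::int)) dvd d \<longleftrightarrow> int (ord g) dvd i * int d"
proof -
  have "(g [^] i) [^] d = g [^] (i * int d)"
    using assms by (simp add: int_pow_pow flip: int_pow_int)
  then show ?thesis
    using assms by (simp add: int_pow_eq_id flip: pow_eq_id)
qed

text \<open>Since \<open>d * m\<close> divides \<open>i * d\<close>, \<open>m\<close> divides
  \<open>i\<close>. A common factor \<open>c\<close> of \<open>d\<close> and the cofactor
  \<open>j\<close> would make the order of \<open>g [^] i\<close> divide \<open>d / c\<close>, so
  \<open>c = 1\<close>.\<close>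

lemma (in group) ord_int_pow_eqD:
  assumes "g \<in> carrier G" and ord_g: "ord g = d * m" and "d > 0" "m > 0"
    and ord_i: "ord (g [^] (i::int)) = d"
  obtains j where "i = int m * j" and "coprime (int d) j"
proof -
  have "int (d * m) dvd i * int d"
    using ord_int_pow_dvd_iff[OF assms(1), of i d] ord_g ord_i by simp
  then have "int m dvd i"
    using \<open>d > 0\<close> by (simp add: mult.commute)
  then obtain j where j: "i = int m * j" ..
  define c where "c = nat (gcd (int d) j)"
  have c: "int c = gcd (int d) j" by (simp add: c_def)
  then obtain d' where d': "d = c * d'"
    by (metis gcd_dvd1 int_dvd_int_iff dvdE)
  obtain j' where j': "j = int c * j'"
    using c by (metis gcd_dvd2 dvdE)
  have "i * int d' = int (ord g) * j'"
    using j j' ord_g d' by (simp add: algebra_simps)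
  then have "d dvd d'"
    using ord_int_pow_dvd_iff[OF assms(1), of i d'] ord_i by simp
  then have "c = 1"
    using d' \<open>d > 0\<close> by (auto dest: dvd_mult_right simp: mult.commute[of c])
  then have "coprime (int d) j"
    using c by (simp add: coprime_iff_gcd_eq_1)
  with j show thesis by (rule that)
qed

text \<open>A divisor of \<open>p\<^sup>2\<close> that does not divide \<open>p\<close> is
  \<open>p\<^sup>2\<close>; a divisor of \<open>p\<close> other than 1 is \<open>p\<close>.\<close>

lemma (in group) ord_int_pow_prime_square:
  assumes "h \<in> carrier G" and "prime p" and "ord h = p\<^sup>2" and "\<not> int p dvd i"
  shows "ord (h [^] i) = p\<^sup>2" and "ord (h [^] (int p * i)) = p"
proof -
  have p: "p > 0" using \<open>prime p\<close> by (rule prime_gt_0_nat)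
  have "ord (h [^] i) dvd p\<^sup>2"
    using assms by (simp add: ord_int_pow_dvd_iff)
  moreover have "\<not> ord (h [^] i) dvd p"
    using assms p by (simp add: ord_int_pow_dvd_iff power2_eq_square)
  ultimately show "ord (h [^] i) = p\<^sup>2"
    unfolding divides_primepow_nat[OF \<open>prime p\<close>] by (auto simp: le_Suc_eq numeral_2_eq_2)
  have "ord (h [^] (int p * i)) dvd p"
    using assms by (simp add: ord_int_pow_dvd_iff power2_eq_square)
  moreover have "\<not> ord (h [^] (int p * i)) dvd 1"
    unfolding ord_int_pow_dvd_iff[OF assms(1)] using assms p by (simp add: power2_eq_square)
  ultimately show "ord (h [^] (int p * i)) = p"
    using \<open>prime p\<close> by (auto simp: prime_nat_iff)
qed

section \<open>Lower bound: \<open>p\<close> colors do not suffice\<close>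

lemma (in group) proper_coloring_BiCay_gt:
  assumes h: "h \<in> carrier G" and "prime p" and ord_h: "ord h = p\<^sup>2"
    and S1: "{x \<in> carrier G. ord x = p} \<subseteq> S1" and S2: "{x \<in> carrier G. ord x = p\<^sup>2} \<subseteq> S2"
    and S3: "\<one> \<in> S3"
    and col: "proper_coloring (BiCay G S1 S2 S3) k c"
  shows "p < k"
proof (rule ccontr)
  assume "\<not> p < k"
  then have lt: "c (i, x) < p" if "i \<in> {0, 1}" "x \<in> carrier G" for i x
    using col that by (force simp: proper_coloring_def BiCay_verts)
  have p: "p > 0" using \<open>prime p\<close> by (rule prime_gt_0_nat)
  note ords = ord_int_pow_prime_square[OF h \<open>prime p\<close> ord_h]
  have layer1: "c (1, h [^] r) \<noteq> c (1, h [^] s)" if "\<not> int p dvd r - s" for r s :: int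
  proof (rule proper_coloring_arc[OF col])
    have "ord (h [^] r \<otimes> inv (h [^] s)) = p\<^sup>2"
      using ords(1)[OF that] h by (simp add: int_pow_diff)
    moreover have "h [^] r \<noteq> h [^] s"
      using calculation h \<open>prime p\<close> by (auto simp: power2_eq_square)
    ultimately show "((1, h [^] r), (1, h [^] s)) \<in> parcs (BiCay G S1 S2 S3)"
      using h S2 by (auto simp: BiCay_arc_iff)
  qed
  have layer0: "c (0, h [^] (int p * a)) \<noteq> c (0, h [^] (int p * b))"
    if "\<not> int p dvd a - b" for a b :: int
  proof (rule proper_coloring_arc[OF col])
    have "ord (h [^] (int p * a) \<otimes> inv (h [^] (int p * b))) = p"
      using ords(2)[OF that] h by (simp add: int_pow_diff right_diff_distrib)
    moreover have "h [^] (int p * a) \<noteq> h [^] (int p * b)"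
      using calculation h \<open>prime p\<close> by auto
    ultimately show "((0, h [^] (int p * a)), (0, h [^] (int p * b))) \<in> parcs (BiCay G S1 S2 S3)"
      using h S1 by (auto simp: BiCay_arc_iff)
  qed
  have ndvd: "\<not> int p dvd int r - int s" if "r < p" "s < p" "r \<noteq> s" for r s
    using that by (simp flip: mod_eq_dvd_iff)
  have surj: "f ` {..<p} = {..<p}" if "inj_on f {..<p}" "\<And>r. f r < p" for f :: "nat \<Rightarrow> nat"
    using that by (intro endo_inj_surj) auto
  have const: "c (1, h [^] (int p * a)) = c (1, h [^] (0::int))" for a
  proof -
    \<comment> \<open>The clique on the exponents \<open>r < p\<close> uses all \<open>p\<close>
      colors, so the color of exponent \<open>p * a\<close> recurs at some \<open>r\<close>. Equal
      colors force \<open>p\<close> to divide \<open>p * a - r\<close>, hence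
      \<open>r = 0\<close>.\<close>
    have "(\<lambda>r. c (1, h [^] int r)) ` {..<p} = {..<p}"
      using layer1 ndvd lt h by (intro surj inj_onI) (blast, simp)
    then have "c (1, h [^] (int p * a)) \<in> (\<lambda>r. c (1, h [^] int r)) ` {..<p}"
      using lt[of 1] h by simp
    then obtain r where r: "r < p" "c (1, h [^] (int p * a)) = c (1, h [^] int r)"
      by blast
    have "int p dvd int p * a - int r"
      using layer1 r(2) by blast
    then have "p dvd r"
      by (metis dvd_diff_right_iff dvd_triv_left int_dvd_int_iff dvd_diff_commute)
    with r show ?thesis by (auto dest: nat_dvd_not_less)
  qed
  \<comment> \<open>The clique in layer 0 also uses every color, in particular the constant one of
    layer 1.\<close>
  have "(\<lambda>a. c (0, h [^] (int p * int a))) ` {..<p} = {..<p}"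
    using layer0 ndvd lt h by (intro surj inj_onI) (blast, simp)
  then have "c (1, h [^] (0::int)) \<in> (\<lambda>a. c (0, h [^] (int p * int a))) ` {..<p}"
    using lt[of 1] h by (metis insertCI int_pow_closed lessThan_iff)
  then obtain a :: nat where a: "c (0, h [^] (int p * int a)) = c (1, h [^] (0::int))"
    by auto
  have "((0, h [^] (int p * int a)), (1, h [^] (int p * int a))) \<in> parcs (BiCay G S1 S2 S3)"
    using h S3 by (simp add: BiCay_arc_iff)
  then show False
    using proper_coloring_arc[OF col] const[of "int a"] a by metis
qed

section \<open>Colorings of the integers by residues and digits\<close>

lemma add_mod_cancel_small:
  fixes a a' b P :: int
  assumes "(a + b) mod P = (a' + b) mod P" and "a \<in> {0..<P}" "a' \<in> {0..<P}"
  shows "a = a'"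
proof -
  have "a mod P = a' mod P"
    using assms(1) by (simp add: mod_eq_dvd_iff)
  with assms(2,3) show ?thesis by simp
qed

text \<open>The two lowest base-\<open>P\<close> digits determine an integer modulo
  \<open>P\<^sup>2\<close>.\<close>

lemma mod_square_eqI:
  fixes s t P :: int
  assumes "0 < P" and "s mod P = t mod P" and "s div P mod P = t div P mod P"
  shows "P\<^sup>2 dvd s - t"
  using assms by (simp add: power2_eq_square zmod_zmult2_eq flip: mod_eq_dvd_iff)

definition residue_color :: "int \<Rightarrow> int \<Rightarrow> int \<Rightarrow> int" where
  "residue_color P Q t = (t mod P + t mod Q) mod P"

definition digit_color :: "int \<Rightarrow> int \<Rightarrow> int \<Rightarrow> int" where
  "digit_color P Q t = (t div P mod P + t div Q mod Q) mod P"

text \<open>One of the two summands agrees at \<open>s\<close> and \<open>t\<close>, so it cancels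
  modulo \<open>P\<close>. The other is already reduced modulo \<open>P\<close>; for the residue
  modulo \<open>Q\<close> this is where \<open>Q < P\<close> enters.\<close>

lemma residue_color_neq:
  assumes "0 < Q" "Q < P" and step: "Q dvd s - t \<and> \<not> P dvd s - t \<or> P dvd s - t \<and> \<not> Q dvd s - t"
  shows "residue_color P Q s \<noteq> residue_color P Q t"
proof
  assume eq: "residue_color P Q s = residue_color P Q t"
  from step show False
  proof (elim disjE conjE)
    assume Q: "Q dvd s - t" and P: "\<not> P dvd s - t"
    have mods: "s mod Q = t mod Q" using Q by (simp add: mod_eq_dvd_iff)
    have "s mod P = t mod P"
      by (rule add_mod_cancel_small[where b = "t mod Q"])
        (use eq mods assms(1,2) in \<open>auto simp: residue_color_def\<close>)
    with P show False by (simp add: mod_eq_dvd_iff)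
  next
    assume P: "P dvd s - t" and Q: "\<not> Q dvd s - t"
    have small: "u mod Q \<in> {0..<P}" for u
      using assms(1,2) order_less_trans[OF pos_mod_bound[OF assms(1)] assms(2)] by simp
    have mods: "s mod P = t mod P" using P by (simp add: mod_eq_dvd_iff)
    have "s mod Q = t mod Q"
      by (rule add_mod_cancel_small[where b = "t mod P"])
        (use eq mods small in \<open>auto simp: residue_color_def add.commute\<close>)
    with Q show False by (simp add: mod_eq_dvd_iff)
  qed
qed

lemma div_mod_cong:
  fixes s t P :: int
  assumes "P\<^sup>2 dvd s - t"
  shows "s div P mod P = t div P mod P"
proof -
  obtain k where "s = t + P * (P * k)"
    using assms by (metis add.commute diff_add_cancel dvdE mult.assoc power2_eq_square)
  then show ?thesis by (cases "P = 0") auto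
qed

text \<open>Cancellation as for \<open>residue_color\<close>. The lowest digits agree, so agreement
  of the next digits would make the square divide \<open>s - t\<close>.\<close>

lemma digit_color_neq:
  assumes "0 < Q" "Q < P" and "P dvd s - t" "Q dvd s - t"
    and step: "Q\<^sup>2 dvd s - t \<and> \<not> P\<^sup>2 dvd s - t \<or> P\<^sup>2 dvd s - t \<and> \<not> Q\<^sup>2 dvd s - t"
  shows "digit_color P Q s \<noteq> digit_color P Q t"
proof
  assume eq: "digit_color P Q s = digit_color P Q t"
  have mods: "s mod P = t mod P" "s mod Q = t mod Q"
    using assms(3,4) by (simp_all add: mod_eq_dvd_iff)
  from step show False
  proof (elim disjE conjE)
    assume Q: "Q\<^sup>2 dvd s - t" and P: "\<not> P\<^sup>2 dvd s - t"
    have "s div P mod P = t div P mod P"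
      by (rule add_mod_cancel_small[where b = "t div Q mod Q"])
        (use eq div_mod_cong[OF Q] assms(1,2) in \<open>auto simp: digit_color_def\<close>)
    with P mods assms(1,2) show False by (simp add: mod_square_eqI)
  next
    assume P: "P\<^sup>2 dvd s - t" and Q: "\<not> Q\<^sup>2 dvd s - t"
    have small: "u mod Q \<in> {0..<P}" for u
      using assms(1,2) order_less_trans[OF pos_mod_bound[OF assms(1)] assms(2)] by simp
    have "s div Q mod Q = t div Q mod Q"
      by (rule add_mod_cancel_small[where b = "t div P mod P"])
        (use eq div_mod_cong[OF P] small in \<open>auto simp: digit_color_def add.commute\<close>)
    with Q mods assms(1,2) show False by (simp add: mod_square_eqI)
  qed
qed

section \<open>Upper bound: exponents along arcs and the coloring\<close>

lemma prime_coprime_not_dvd: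
  assumes "prime p" and "coprime (int p) i"
  shows "\<not> int p dvd i"
proof
  assume "int p dvd i"
  then have "is_unit (int p)"
    by (rule coprime_common_divisor[OF assms(2) dvd_refl])
  then show False
    using prime_gt_1_nat[OF assms(1)] by simp
qed

text \<open>The exponent is \<open>q\<^sup>2 * j\<close> with \<open>j\<close> coprime to
  \<open>p\<close>: the shift made by an arc of layer 1.\<close>

lemma (in group) ord_int_pow_eq_prime_squareD:
  assumes "g \<in> carrier G" "ord g = p\<^sup>2 * q\<^sup>2" "prime p" "prime q" "p \<noteq> q"
    and "ord (g [^] (i::int)) = p\<^sup>2"
  shows "int q dvd i" and "\<not> int p dvd i"
proof -
  obtain j where j: "i = int (q\<^sup>2) * j" "coprime (int (p\<^sup>2)) j"
    using ord_int_pow_eqD[OF assms(1,2) _ _ assms(6)] assms(3,4) by (auto simp: prime_gt_0_nat)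
  then show "int q dvd i" by (simp add: power2_eq_square)
  have "coprime (int p) (int q)"
    using assms(3-5) by (simp add: primes_coprime)
  then have "coprime (int p) i"
    using j by simp
  then show "\<not> int p dvd i"
    by (rule prime_coprime_not_dvd[OF assms(3)])
qed

text \<open>The exponent is \<open>p * q\<^sup>2 * j\<close> with \<open>j\<close> coprime to
  \<open>p\<close>, so it contains the factor \<open>p\<close> exactly once: the shift made by an
  arc of layer 0.\<close>

lemma (in group) ord_int_pow_eq_primeD:
  assumes "g \<in> carrier G" "ord g = p\<^sup>2 * q\<^sup>2" "prime p" "prime q" "p \<noteq> q"
    and "ord (g [^] (i::int)) = p"
  shows "int p dvd i" and "(int q)\<^sup>2 dvd i" and "\<not> (int p)\<^sup>2 dvd i"
proof -
  have "ord g = p * (p * q\<^sup>2)" using assms(2) by (simp add: power2_eq_square)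
  then obtain j where j: "i = int (p * q\<^sup>2) * j" "coprime (int p) j"
    using ord_int_pow_eqD[OF assms(1) _ _ _ assms(6), of "p * q\<^sup>2"] assms(3,4)
    by (auto simp: prime_gt_0_nat)
  then show "int p dvd i" "(int q)\<^sup>2 dvd i" by simp_all
  have "coprime (int p) (int q)"
    using assms(3-5) by (simp add: primes_coprime)
  then have "coprime (int p) ((int q)\<^sup>2 * j)"
    using j by simp
  then have "\<not> int p dvd (int q)\<^sup>2 * j"
    by (rule prime_coprime_not_dvd[OF assms(3)])
  then show "\<not> (int p)\<^sup>2 dvd i"
    using j(1) prime_gt_0_nat[OF assms(3)] by (simp add: power2_eq_square mult.assoc)
qed

lemma (in group) ex_proper_coloring_BiCay:
  assumes "g \<in> carrier G" and gen: "carrier G = range (\<lambda>n::int. g [^] n)"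
    and ord_g: "ord g = p\<^sup>2 * q\<^sup>2" and "prime p" "prime q" "q < p"
  shows "\<exists>c. proper_coloring (BiCay G {x \<in> carrier G. ord x = p \<or> ord x = q}
    {x \<in> carrier G. ord x = p\<^sup>2 \<or> ord x = q\<^sup>2} {\<one>}) (p + 1) c"
    (is "\<exists>c. proper_coloring ?\<Gamma> _ c")
proof -
  \<comment> \<open>A discrete logarithm. Any choice of exponents serves, because colors are
    compared only through divisibility of \<open>e x - e y\<close>.\<close>
  define e where "e x = (SOME n::int. x = g [^] n)" for x
  have e: "g [^] e x = x" if "x \<in> carrier G" for x
    using someI_ex[of "\<lambda>n::int. x = g [^] n"] that gen unfolding e_def by (metis rangeE)
  have pq: "0 < int q" "int q < int p" "p \<noteq> q"
    using assms by (auto simp: prime_gt_0_nat)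
  have ord_g': "ord g = q\<^sup>2 * p\<^sup>2" using ord_g by simp
  have quot: "x \<otimes> inv y = g [^] (e x - e y)" if "x \<in> carrier G" "y \<in> carrier G" for x y
    using e that assms(1) by (simp add: int_pow_diff)
  let ?F = "\<lambda>x. residue_color p q (e x)" and ?A = "\<lambda>x. digit_color p q (e x)"
  have range: "?F x \<in> {0..<int p}" "?A x \<in> {0..<int p}" for x
    using pq by (auto simp: residue_color_def digit_color_def)
  have layer1: "?F x \<noteq> ?F y"
    if "x \<in> carrier G" "y \<in> carrier G" "ord (x \<otimes> inv y) = p\<^sup>2 \<or> ord (x \<otimes> inv y) = q\<^sup>2" for x y
    using that pq assms
      ord_int_pow_eq_prime_squareD[OF assms(1) ord_g assms(4,5), of "e x - e y"]
      ord_int_pow_eq_prime_squareD[OF assms(1) ord_g' assms(5,4), of "e x - e y"]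
    by (intro residue_color_neq) (auto simp: quot)
  have layer0: "?A x \<noteq> ?A y \<and> ?F x = ?F y"
    if "x \<in> carrier G" "y \<in> carrier G" "ord (x \<otimes> inv y) = p \<or> ord (x \<otimes> inv y) = q" for x y
  proof -
    note D = ord_int_pow_eq_primeD[OF assms(1) ord_g assms(4,5), of "e x - e y"]
      ord_int_pow_eq_primeD[OF assms(1) ord_g' assms(5,4), of "e x - e y"]
    have dvd: "int p dvd e x - e y" "int q dvd e x - e y"
      using that D pq(3) by (auto simp: quot power2_eq_square intro: dvd_mult_left)
    moreover have "?A x \<noteq> ?A y"
      using that D pq dvd by (intro digit_color_neq) (auto simp: quot)
    moreover have "?F x = ?F y"
      using dvd by (simp add: residue_color_def flip: mod_eq_dvd_iff)
    ultimately show ?thesis by blast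
  qed
  define c where "c = (\<lambda>(i::nat, x).
    nat (if i = 1 then ?F x else if ?A x = ?F x then int p else ?A x))"
  have c1: "c (1, x) = nat (?F x)" for x by (simp add: c_def)
  have c0: "c (0, x) = nat (if ?A x = ?F x then int p else ?A x)" for x by (simp add: c_def)
  have nat_eq: "nat a = nat b \<longleftrightarrow> a = b" if "0 \<le> a" "0 \<le> b" for a b
    using that by auto
  have cross: "c (0, x) \<noteq> c (1, x)" for x
    using range[of x] unfolding c0 c1 by (auto simp: nat_eq)
  \<comment> \<open>The extra color \<open>p\<close> cannot appear at both ends: that would mean
    \<open>?A = ?F\<close> at both, while \<open>?F\<close> agrees there and \<open>?A\<close> does
    not.\<close>
  have same0: "c (0, x) \<noteq> c (0, y)" if "?A x \<noteq> ?A y \<and> ?F x = ?F y" for x y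
    using that range[of x] range[of y] unfolding c0 by (auto simp: nat_eq)
  have same1: "c (1, x) \<noteq> c (1, y)" if "?F x \<noteq> ?F y" for x y
    using that range[of x] range[of y] unfolding c1 by (auto simp: nat_eq)
  have "proper_coloring ?\<Gamma> (p + 1) c"
    unfolding proper_coloring_def
  proof (intro conjI ballI)
    fix v assume "v \<in> pverts ?\<Gamma>"
    obtain i x where "v = (i, x)" by (cases v)
    then show "c v < p + 1"
      using range[of x] by (auto simp: c_def)
  next
    fix a assume a: "a \<in> parcs ?\<Gamma>"
    obtain i x j y where eq: "a = ((i, x), (j, y))"
      by (metis surj_pair)
    have xy: "x \<in> carrier G" "y \<in> carrier G"
      using a unfolding eq BiCay_arc_iff by auto
    \<comment> \<open>Arcs between the layers join only the two copies of one element, the case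
      settled by \<open>cross\<close>.\<close>
    have "x = y" if "x \<otimes> inv y = \<one>"
      using that xy inv_equality[of x "inv y"] by simp
    then show "case a of (u, v) \<Rightarrow> c u \<noteq> c v"
      using a same0[OF layer0[OF xy]] same1[OF layer1[OF xy]] cross[of x] cross[of x, symmetric]
      unfolding eq BiCay_arc_iff by auto
  qed
  then show ?thesis by (rule exI[of _ c])
qed

lemma (in group) chromatic_number_BiCay:
  assumes "cyclic_group G" and "prime p" "prime q" "q < p" and "order G = p\<^sup>2 * q\<^sup>2"
  shows "chromatic_number (BiCay G {x \<in> carrier G. ord x = p \<or> ord x = q}
    {x \<in> carrier G. ord x = p\<^sup>2 \<or> ord x = q\<^sup>2} {\<one>}) = p + 1"
    (is "chromatic_number ?\<Gamma> = _")
proof -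
  obtain g where g: "g \<in> carrier G" and gen: "carrier G = range (\<lambda>n::int. g [^] n)"
    using assms(1) by (auto simp: cyclic_group)
  have pos: "p > 0" "q > 0"
    using assms by (auto simp: prime_gt_0_nat)
  have ord_g: "ord g = p\<^sup>2 * q\<^sup>2"
    using generate_pow_card[OF g] generate_pow[OF g] gen assms(5)
    by (simp add: order_def full_SetCompr_eq)
  obtain c where c: "proper_coloring ?\<Gamma> (p + 1) c"
    using ex_proper_coloring_BiCay[OF g gen ord_g assms(2-4)] ..
  \<comment> \<open>This power of the generator serves as \<open>h\<close> in the lower
    bound.\<close>
  have "ord (g [^] q\<^sup>2) = p\<^sup>2"
    using ord_pow[OF g, of "q\<^sup>2"] ord_g pos by simp
  then have "p < l" if "proper_coloring ?\<Gamma> l c" for l c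
    using that by (intro proper_coloring_BiCay_gt[OF nat_pow_closed[OF g] assms(2)]) auto
  with c show ?thesis
    by (intro chromatic_number_eqI[OF c]) (simp add: Suc_leI)
qed

theorem theorem2p23:
  fixes G (structure) and p q :: nat and S1 S2 S3 :: "'a set"
  assumes "group G" and "cyclic_group G"
    and "prime p" and "prime q" and "p \<noteq> q"
    and "order G = p\<^sup>2 * q\<^sup>2"
    and "S1 = {x \<in> carrier G. group.ord G x = p \<or> group.ord G x = q}"
    and "S2 = {x \<in> carrier G. group.ord G x = p\<^sup>2 \<or> group.ord G x = q\<^sup>2}"
    and "S3 = {\<one>}"
  shows "chromatic_number (BiCay G S1 S2 S3) = max p q + 1"
proof -
  interpret group G by fact
  consider "q < p" | "p < q" using \<open>p \<noteq> q\<close> by linarith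
  then show ?thesis
  proof cases
    case 1
    then show ?thesis
      using chromatic_number_BiCay[OF assms(2,3,4) 1] assms(6-9) by simp
  next
    \<comment> \<open>Order and connection sets are symmetric in \<open>p\<close> and
      \<open>q\<close>, so the roles are exchanged.\<close>
    case 2
    then show ?thesis
      using chromatic_number_BiCay[OF assms(2,4,3) 2] assms(6-9)
      by (simp add: mult.commute disj_commute)
  qed
qed

end
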